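(* For each row below and each positive integer $l$ (with $l\ge 2$ in row 9), there exists a partial geometric design with $v=12$ points and the listed parameters $(b,k,r;\alpha,\beta)$ whose concurrence matrix (for a suitable ordering of the points) is the listed $12\times12$ symmetric circulant matrix $C[c_0,c_1,c_2,c_3,c_4,c_5,c_6]$, and whose concurrence matrix has spectrum $[(kr)^1,n^{\sigma},0^{11-\sigma}]$ with $n^\sigma$ as listed: 1. $C[4l,l,l,0,l,l,0]$, $k=3$, $n^\sigma=(4l)^9$, $(b,r;\alpha,\beta)=(16l,4l;2l,6l)$; 2. $C[3l,l,0,l,0,l,3l]$, $k=4$, $(6l)^4$, $(9l,3l;2l,8l)$; 3. $C[5l,l,l,l,l,l,5l]$, $k=4$, $(8l)^5$, $(15l,5l;4l,12l)$; 4. $C[4l,l,l,2l,l,l,0]$, $k=4$, $(4l)^8$, $(12l,4l;4l,8l)$; 5. $C[3l,l,l,l,0,l,l]$, $k=4$, $(3l)^8$, $(9l,3l;3l,6l)$; 6. $C[2l,l,l,0,l,l,2l]$, $k=6$, $(4l)^3$, $(4l,2l;4l,8l)$; 7. $C[3l,l,l,l,3l,l,l]$, $k=6$, $(6l)^3$, $(6l,3l;6l,12l)$; 8. $C[5l,2l,2l,2l,2l,2l,5l]$, $k=6$, $(6l)^5$, $(10l,5l;12l,18l)$; 9. $C[2l,l,l,l,l,l,0]$, $k=6$, $(2l)^6$, $(4l,2l;5l,7l)$, for $l\ge 2$; 10. $C[7l,3l,4l,3l,4l,3l,l]$, $k=6$, $(6l)^7$, $(14l,7l;18l,24l)$; 11.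 $C[6l,3l,3l,2l,3l,3l,2l]$, $k=6$, $(4l)^9$, $(12l,6l;16l,20l)$. In particular there are at least 11 infinite families of $12\times 12$ symmetric integral circulant matrices that are realized as concurrence matrices of partial geometric designs.
   Context: A partial geometric design with parameters $(v,b,k,r;\alpha,\beta)$ is a tactical configuration with $v$ points and $b$ blocks (repeated blocks allowed), each block of size $k$, each point in $r$ blocks, whose $v\times b$ incidence matrix $N$ satisfies $NN^TN=\beta N+\alpha(J-N)$ ($J$ all-ones); its concurrence matrix is $NN^T$, whose $(x,y)$ entry is the number of blocks containing $x$ and $y$. For a $12\times 12$ symmetric circulant matrix, $C[c_0,c_1,c_2,c_3,c_4,c_5,c_6]$ denotes the circulant matrix with first row $[c_0,c_1,c_2,c_3,c_4,c_5,c_6,c_5,c_4,c_3,c_2,c_1]$. Spectra are written with multiplicities as exponents. *)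

theory Defs
  imports
    Complex_Main
    "HOL-Library.Multiset"
    "HOL-Library.Disjoint_Sets"
    "Jordan_Normal_Form.Char_Poly"
begin

text \<open>A configuration is a set of points together with a multiset of blocks (subsets of the
  point set), so that repeated blocks are allowed.\<close>

definition tactical_configuration ::
  "'a set \<Rightarrow> 'a set multiset \<Rightarrow> nat \<Rightarrow> nat \<Rightarrow> nat \<Rightarrow> nat \<Rightarrow> bool" where
  "tactical_configuration V \<B> v b k r \<longleftrightarrow>
     finite V \<and> card V = v \<and> size \<B> = b \<and>
     (\<forall>B \<in># \<B>. B \<subseteq> V \<and> card B = k) \<and>
     (\<forall>x \<in> V. size {#B \<in># \<B>. x \<in> B#} = r)"

definition is_ordering ::
  "'a list \<Rightarrow> 'a set list \<Rightarrow> 'a set \<Rightarrow> 'a set multiset \<Rightarrow> bool" where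
  "is_ordering ps bs V \<B> \<longleftrightarrow> distinct ps \<and> set ps = V \<and> mset bs = \<B>"

definition incidence_matrix :: "'a list \<Rightarrow> 'a set list \<Rightarrow> int mat" where
  "incidence_matrix ps bs =
     mat (length ps) (length bs) (\<lambda>(i, j). if ps ! i \<in> bs ! j then 1 else 0)"

definition concurrence_matrix :: "'a list \<Rightarrow> 'a set list \<Rightarrow> int mat" where
  "concurrence_matrix ps bs = incidence_matrix ps bs * transpose_mat (incidence_matrix ps bs)"

definition all_ones_mat :: "nat \<Rightarrow> nat \<Rightarrow> int mat" where
  "all_ones_mat m n = mat m n (\<lambda>_. 1)"

text \<open>The matrix equation does not depend on how points and blocks are ordered; it is required
  for every ordering.\<close>

definition partial_geometric_design ::
  "'a set \<Rightarrow> 'a set multiset \<Rightarrow> nat \<Rightarrow> nat \<Rightarrow> nat \<Rightarrow> nat \<Rightarrow> nat \<Rightarrow> nat \<Rightarrow> bool" where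
  "partial_geometric_design V \<B> v b k r \<alpha> \<beta> \<longleftrightarrow>
     tactical_configuration V \<B> v b k r \<and>
     (\<forall>ps bs. is_ordering ps bs V \<B> \<longrightarrow>
        (let N = incidence_matrix ps bs in
           N * transpose_mat N * N =
             int \<beta> \<cdot>\<^sub>m N + int \<alpha> \<cdot>\<^sub>m (all_ones_mat v b - N)))"

definition circulant_mat :: "'a list \<Rightarrow> 'a mat" where
  "circulant_mat c =
     (let n = length c in mat n n (\<lambda>(i, j). c ! ((j + n - i) mod n)))"

definition sym_circulant12 ::
  "nat \<Rightarrow> nat \<Rightarrow> nat \<Rightarrow> nat \<Rightarrow> nat \<Rightarrow> nat \<Rightarrow> nat \<Rightarrow> int mat" where
  "sym_circulant12 c0 c1 c2 c3 c4 c5 c6 =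
     circulant_mat (map int [c0, c1, c2, c3, c4, c5, c6, c5, c4, c3, c2, c1])"

definition spectrum_mset :: "int mat \<Rightarrow> complex multiset" where
  "spectrum_mset M = proots (char_poly (map_mat complex_of_int M))"

text \<open>\<open>realized12 M k n \<sigma> b r \<alpha> \<beta>\<close>: some partial geometric design with parameters
  \<open>(12, b, k, r; \<alpha>, \<beta>)\<close> has, for a suitable ordering of its points, concurrence matrix \<open>M\<close>,
  and this matrix has spectrum \<open>[(kr)^1, n^\<sigma>, 0^(11 - \<sigma>)]\<close>.\<close>

definition realized12 ::
  "int mat \<Rightarrow> nat \<Rightarrow> nat \<Rightarrow> nat \<Rightarrow> nat \<Rightarrow> nat \<Rightarrow> nat \<Rightarrow> nat \<Rightarrow> bool" where
  "realized12 M k n \<sigma> b r \<alpha> \<beta> \<longleftrightarrow>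
     (\<exists>(V :: nat set) \<B> ps bs.
        partial_geometric_design V \<B> 12 b k r \<alpha> \<beta> \<and>
        is_ordering ps bs V \<B> \<and>
        concurrence_matrix ps bs = M \<and>
        spectrum_mset (concurrence_matrix ps bs) =
          {#of_nat (k * r)#} + replicate_mset \<sigma> (of_nat n) + replicate_mset (11 - \<sigma>) 0)"

definition is_pgd_concurrence_matrix :: "int mat \<Rightarrow> bool" where
  "is_pgd_concurrence_matrix M \<longleftrightarrow>
     (\<exists>(V :: nat set) \<B> v b k r \<alpha> \<beta> ps bs.
        partial_geometric_design V \<B> v b k r \<alpha> \<beta> \<and>
        is_ordering ps bs V \<B> \<and>
        concurrence_matrix ps bs = M)"

text \<open>``Integral'' is taken in both senses: the entries are integers (by the type of the
  matrix) and so are all eigenvalues.\<close>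

definition sym_integral_circulant :: "nat \<Rightarrow> int mat \<Rightarrow> bool" where
  "sym_integral_circulant n M \<longleftrightarrow>
     M \<in> carrier_mat n n \<and> transpose_mat M = M \<and>
     (\<exists>c. length c = n \<and> M = circulant_mat c) \<and>
     set_mset (spectrum_mset M) \<subseteq> \<int>"

end

theory Submission
  imports Defs "Jordan_Normal_Form.Schur_Decomposition"
begin

text \<open>Write \<open>M = l C\<close> for the prescribed concurrence matrix. Once the concurrence matrix is \<open>M\<close>,
  the equation \<open>N N\<^sup>T N = \<beta> N + \<alpha> (J - N)\<close> is a condition on single blocks that is homogeneous
  in \<open>l\<close>: every block \<open>B\<close> has \<open>\<Sum>y\<in>B. C x y\<close> equal to \<open>\<beta>/l\<close> or \<open>\<alpha>/l\<close> according to whether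
  \<open>x \<in> B\<close>. Hence the union of designs for \<open>l\<close> and \<open>l'\<close> is a design for \<open>l + l'\<close>, and one explicit
  design with \<open>l = 1\<close> suffices for each row except row 9, which needs \<open>l = 2\<close> and \<open>l = 3\<close>.

  The spectrum depends only on the parameters: the design equation gives
  \<open>M\<^sup>2 = (\<beta> - \<alpha>) M + \<alpha> r J\<close>, so the all-ones vector has eigenvalue \<open>kr\<close>, the other eigenvalues are
  \<open>\<beta> - \<alpha>\<close> and \<open>0\<close>, and the traces of \<open>M\<close> and \<open>M\<^sup>2\<close> fix the multiplicities.\<close>

section \<open>Traces and power sums of eigenvalues\<close>

definition mat_trace :: "'a :: comm_monoid_add mat \<Rightarrow> 'a" where
  "mat_trace A = (\<Sum>i<dim_row A. A $$ (i, i))"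

lemma mat_trace_mult_commute:
  fixes A B :: "'a :: comm_semiring_0 mat"
  assumes "A \<in> carrier_mat m n" "B \<in> carrier_mat n m"
  shows "mat_trace (A * B) = mat_trace (B * A)"
proof -
  have "mat_trace (A * B) = (\<Sum>i<m. \<Sum>j<n. A $$ (i, j) * B $$ (j, i))"
    using assms by (auto simp: mat_trace_def scalar_prod_def lessThan_atLeast0)
  also have "\<dots> = (\<Sum>j<n. \<Sum>i<m. B $$ (j, i) * A $$ (i, j))"
    by (subst sum.swap) (simp add: mult.commute)
  also have "\<dots> = mat_trace (B * A)"
    using assms by (auto simp: mat_trace_def scalar_prod_def lessThan_atLeast0)
  finally show ?thesis .
qed

lemma mat_trace_similar:
  fixes A B :: "'a :: comm_ring_1 mat"
  assumes "similar_mat A B"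
  shows "mat_trace A = mat_trace B"
proof -
  define n where "n = dim_row A"
  obtain P Q where "similar_mat_wit A B P Q"
    using assms by (auto simp: similar_mat_def)
  note wit = similar_mat_witD[OF n_def this]
  have "mat_trace (P * B * Q) = mat_trace (Q * (P * B))"
    using wit(5-7) by (intro mat_trace_mult_commute) auto
  also have "Q * (P * B) = B"
    using wit(2,5-7) by (simp flip: assoc_mult_mat[of Q n n P n B n])
  finally show ?thesis
    by (simp flip: wit(3))
qed

lemma upper_triangular_mult:
  fixes A B :: "'a :: semiring_0 mat"
  assumes "A \<in> carrier_mat n n" "B \<in> carrier_mat n n" "upper_triangular A" "upper_triangular B"
  shows "upper_triangular (A * B)"
    and "i < n \<Longrightarrow> (A * B) $$ (i, i) = A $$ (i, i) * B $$ (i, i)"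
proof -
  have entry: "(A * B) $$ (i, j) = (\<Sum>k<n. A $$ (i, k) * B $$ (k, j))" if "i < n" "j < n" for i j
    using that assms by (simp add: scalar_prod_def lessThan_atLeast0)
  have zero: "A $$ (i, k) * B $$ (k, j) = 0" if "i < n" "k < n" "j \<le> i" "k \<noteq> i \<or> j < i" for i j k
  proof (cases "k < i")
    case True
    then show ?thesis using upper_triangularD[OF assms(3) True] assms(1) that by simp
  next
    case False
    then have "j < k" using that by linarith
    then show ?thesis using upper_triangularD[OF assms(4)] assms(2) that by simp
  qed
  show "upper_triangular (A * B)"
    using assms(1,2) by (intro upper_triangularI) (simp add: entry zero del: index_mult_mat(1))
  show "(A * B) $$ (i, i) = A $$ (i, i) * B $$ (i, i)" if i: "i < n"
  proof -
    have "(A * B) $$ (i, i) = (\<Sum>k<n. if k = i then A $$ (i, i) * B $$ (i, i) else 0)"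
      unfolding entry[OF i i] using zero i by (intro sum.cong) auto
    then show ?thesis using i by simp
  qed
qed

lemma upper_triangular_pow:
  fixes A :: "'a :: comm_semiring_1 mat"
  assumes "A \<in> carrier_mat n n" "upper_triangular A"
  shows "upper_triangular (A ^\<^sub>m k) \<and> (\<forall>i<n. (A ^\<^sub>m k) $$ (i, i) = A $$ (i, i) ^ k)"
proof (induction k)
  case 0
  then show ?case using assms(1) by simp
next
  case (Suc k)
  then show ?case
    using upper_triangular_mult[OF pow_carrier_mat[OF assms(1)] assms(1) _ assms(2)]
    by (simp add: mult.commute)
qed

lemma proots_prod_list_linear:
  fixes xs :: "'a :: idom list"
  shows "proots (\<Prod>x\<leftarrow>xs. [:- x, 1:]) = mset xs"
proof (induction xs)
  case (Cons x xs)
  have "(\<Prod>x\<leftarrow>xs. [:- x, 1:]) \<noteq> 0"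
    by (auto simp: prod_list_zero_iff)
  then show ?case
    using Cons by (simp add: proots_mult del: mult_pCons_left)
qed simp

lemma sum_proots_char_poly_power:
  fixes A :: "complex mat"
  assumes A: "A \<in> carrier_mat n n"
  shows "(\<Sum>x\<in>#proots (char_poly A). x ^ k) = mat_trace (A ^\<^sub>m k)"
proof -
  obtain as where "char_poly A = (\<Prod>a\<leftarrow>as. [:- a, 1:])"
    using char_poly_factorized[OF A] by blast
  then obtain T where T: "T \<in> carrier_mat n n" "upper_triangular T" and sim: "similar_mat A T"
    using schur_decomposition_exists[OF A] by blast
  have "char_poly A = (\<Prod>a\<leftarrow>diag_mat T. [:- a, 1:])"
    using char_poly_similar[OF sim] char_poly_upper_triangular[OF T] by simp
  then have "proots (char_poly A) = mset (diag_mat T)"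
    by (simp only: proots_prod_list_linear)
  then have "proots (char_poly A) = image_mset (\<lambda>i. T $$ (i, i)) (mset_set {..<n})"
    using T(1) by (simp add: diag_mat_def lessThan_atLeast0)
  then have "(\<Sum>x\<in>#proots (char_poly A). x ^ k) = (\<Sum>i<n. T $$ (i, i) ^ k)"
    by (simp add: sum_unfold_sum_mset image_mset.compositionality o_def)
  also have "\<dots> = mat_trace (T ^\<^sub>m k)"
    using upper_triangular_pow[OF T] T(1) by (simp add: mat_trace_def)
  also have "\<dots> = mat_trace (A ^\<^sub>m k)"
    using sim similar_mat_wit_pow[of A T _ _ k]
    by (intro mat_trace_similar[symmetric]) (auto simp: similar_mat_def)
  finally show ?thesis .
qed

section \<open>Matrices whose square lies in the span of the matrix itself and the all-ones matrix\<close>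

lemma mult_vec_quadratic_modulo_ones:
  fixes A :: "'a :: field mat"
  assumes A: "A \<in> carrier_mat v v"
    and square: "A * A = n \<cdot>\<^sub>m A + c \<cdot>\<^sub>m mat v v (\<lambda>_. 1)"
    and w: "w \<in> carrier_vec v"
  shows "A *\<^sub>v (A *\<^sub>v w) = n \<cdot>\<^sub>v (A *\<^sub>v w) + (c * (\<Sum>i<v. w $ i)) \<cdot>\<^sub>v vec v (\<lambda>_. 1)"
proof (rule eq_vecI)
  fix i assume "i < dim_vec (n \<cdot>\<^sub>v (A *\<^sub>v w) + (c * (\<Sum>i<v. w $ i)) \<cdot>\<^sub>v vec v (\<lambda>_. 1))"
  then have i: "i < v" using A by simp
  have "(A *\<^sub>v (A *\<^sub>v w)) $ i = ((A * A) *\<^sub>v w) $ i"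
    using assoc_mult_mat_vec[OF A A w] by simp
  also have "\<dots> = (\<Sum>j<v. (n * A $$ (i, j) + c) * w $ j)"
    unfolding square using A w i by (simp add: scalar_prod_def lessThan_atLeast0)
  also have "\<dots> = (n \<cdot>\<^sub>v (A *\<^sub>v w) + (c * (\<Sum>i<v. w $ i)) \<cdot>\<^sub>v vec v (\<lambda>_. 1)) $ i"
    using A w i by (simp add: scalar_prod_def lessThan_atLeast0 distrib_right sum.distrib
        sum_distrib_left mult.assoc)
  finally show "(A *\<^sub>v (A *\<^sub>v w)) $ i =
      (n \<cdot>\<^sub>v (A *\<^sub>v w) + (c * (\<Sum>i<v. w $ i)) \<cdot>\<^sub>v vec v (\<lambda>_. 1)) $ i" .
qed (use A in simp)

lemma mult_ones_vec_eq_iff_row_sums: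
  fixes A :: "'a :: semiring_1 mat"
  assumes "A \<in> carrier_mat v v"
  shows "A *\<^sub>v vec v (\<lambda>_. 1) = s \<cdot>\<^sub>v vec v (\<lambda>_. 1) \<longleftrightarrow> (\<forall>i<v. (\<Sum>j<v. A $$ (i, j)) = s)"
  using assms by (auto simp: vec_eq_iff scalar_prod_def lessThan_atLeast0)

text \<open>An eigenvector for an eigenvalue outside \<open>{n, 0}\<close> is a multiple of the all-ones vector.\<close>

lemma eigenvalue_quadratic_modulo_ones:
  fixes A :: "'a :: field mat"
  assumes A: "A \<in> carrier_mat v v"
    and square: "A * A = n \<cdot>\<^sub>m A + c \<cdot>\<^sub>m mat v v (\<lambda>_. 1)"
    and ones: "A *\<^sub>v vec v (\<lambda>_. 1) = s \<cdot>\<^sub>v vec v (\<lambda>_. 1)"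
    and ev: "eigenvalue A x"
  shows "x \<in> {s, n, 0}"
proof (rule ccontr)
  assume x: "x \<notin> {s, n, 0}"
  obtain w where w: "w \<in> carrier_vec v" "w \<noteq> 0\<^sub>v v" "A *\<^sub>v w = x \<cdot>\<^sub>v w"
    using ev A by (auto simp: eigenvalue_def eigenvector_def)
  define t where "t = c * (\<Sum>i<v. w $ i) / (x * (x - n))"
  have "x \<cdot>\<^sub>v (x \<cdot>\<^sub>v w) = n \<cdot>\<^sub>v (x \<cdot>\<^sub>v w) + (c * (\<Sum>i<v. w $ i)) \<cdot>\<^sub>v vec v (\<lambda>_. 1)"
    using mult_vec_quadratic_modulo_ones[OF A square w(1)] w(1,3) mult_mat_vec[OF A w(1)] by simp
  then have "x * (x - n) * w $ i = c * (\<Sum>i<v. w $ i)" if "i < v" for i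
    using that w(1) by (auto simp: vec_eq_iff algebra_simps)
  then have w_ones: "w = t \<cdot>\<^sub>v vec v (\<lambda>_. 1)"
    using w(1) x by (intro eq_vecI) (simp_all add: t_def field_simps)
  have "A *\<^sub>v w = s \<cdot>\<^sub>v w"
    using mult_mat_vec[OF A, of "vec v (\<lambda>_. 1)" t] ones
    by (simp add: w_ones smult_smult_assoc mult.commute)
  then have "x * w $ i = s * w $ i" if "i < v" for i
    using that w by (metis carrier_vecD index_smult_vec(1))
  then have "w = 0\<^sub>v v"
    using w(1) x by (intro eq_vecI) auto
  with w(2) show False by contradiction
qed

lemma row_sum_quadratic_modulo_ones:
  fixes A :: "'a :: field mat"
  assumes A: "A \<in> carrier_mat v v"
    and square: "A * A = n \<cdot>\<^sub>m A + c \<cdot>\<^sub>m mat v v (\<lambda>_. 1)"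
    and ones: "A *\<^sub>v vec v (\<lambda>_. 1) = s \<cdot>\<^sub>v vec v (\<lambda>_. 1)"
    and "v > 0"
  shows "s * s = n * s + c * of_nat v"
proof -
  have "s \<cdot>\<^sub>v (s \<cdot>\<^sub>v vec v (\<lambda>_. 1)) =
      n \<cdot>\<^sub>v (s \<cdot>\<^sub>v vec v (\<lambda>_. 1)) + (c * of_nat v) \<cdot>\<^sub>v vec v (\<lambda>_. 1)"
    using mult_vec_quadratic_modulo_ones[OF A square, of "vec v (\<lambda>_. 1)"] ones
      mult_mat_vec[OF A, of "vec v (\<lambda>_. 1)" s] by simp
  then show ?thesis
    using \<open>v > 0\<close> by (auto simp: vec_eq_iff)
qed

lemma mat_trace_square_quadratic_modulo_ones:
  fixes A :: "'a :: semiring_1 mat"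
  assumes "A \<in> carrier_mat v v" "A * A = n \<cdot>\<^sub>m A + c \<cdot>\<^sub>m mat v v (\<lambda>_. 1)"
  shows "mat_trace (A * A) = n * mat_trace A + of_nat v * c"
  using assms by (simp add: mat_trace_def sum.distrib sum_distrib_left)

lemma proots_char_poly_quadratic_modulo_ones:
  fixes A :: "complex mat"
  assumes A: "A \<in> carrier_mat v v"
    and square: "A * A = n \<cdot>\<^sub>m A + c \<cdot>\<^sub>m mat v v (\<lambda>_. 1)"
    and ones: "A *\<^sub>v vec v (\<lambda>_. 1) = s \<cdot>\<^sub>v vec v (\<lambda>_. 1)"
    and trace: "mat_trace A = s + of_nat \<sigma> * n"
    and nz: "n \<noteq> 0" "c \<noteq> 0" "v > 0"
  shows "proots (char_poly A) = {#s#} + replicate_mset \<sigma> n + replicate_mset (v - 1 - \<sigma>) 0"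
proof -
  define E where "E = proots (char_poly A)"
  define i j k where "i = count E s" and "j = count E n" and "k = count E 0"
  note s = row_sum_quadratic_modulo_ones[OF A square ones nz(3)]
  then have distinct: "s \<noteq> n" "s \<noteq> 0"
    using nz by auto
  have "char_poly A \<noteq> 0"
    using degree_monic_char_poly[OF A] by auto
  then have "set_mset E \<subseteq> {s, n, 0}"
    using eigenvalue_quadratic_modulo_ones[OF A square ones] eigenvalue_root_char_poly[OF A]
    by (auto simp: E_def)
  then have E: "E = replicate_mset i s + replicate_mset j n + replicate_mset k 0"
    using distinct nz by (intro multiset_eqI) (auto simp: i_def j_def k_def not_in_iff[symmetric])
  have size: "i + j + k = v"
    using arg_cong[OF E, of size] size_proots_complex[of "char_poly A"] degree_monic_char_poly[OF A]
    by (simp add: E_def)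
  have "mat_trace A = (\<Sum>x\<in>#E. x)"
    using sum_proots_char_poly_power[OF A, of 1] A by (simp add: E_def)
  also have "\<dots> = of_nat i * s + of_nat j * n"
    by (subst E) simp
  finally have trace_mult: "of_nat i * s + of_nat j * n = s + of_nat \<sigma> * n"
    by (simp add: trace)
  have "n * mat_trace A + c * of_nat v = mat_trace (A * A)"
    using mat_trace_square_quadratic_modulo_ones[OF A square] by (simp add: mult.commute)
  also have "\<dots> = (\<Sum>x\<in>#E. x\<^sup>2)"
    using sum_proots_char_poly_power[OF A, of 2] A by (simp add: E_def numeral_2_eq_2)
  also have "\<dots> = of_nat i * (s * s) + of_nat j * (n * n)"
    by (subst E) (simp add: power2_eq_square)
  also have "\<dots> = n * (of_nat i * s + of_nat j * n) + of_nat i * (c * of_nat v)"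
    by (simp add: s algebra_simps)
  finally have "of_nat i * (c * of_nat v) = c * of_nat v"
    by (simp add: trace_mult trace)
  then have i: "i = 1" using nz by simp
  then have j: "j = \<sigma>" using trace_mult nz by simp
  show ?thesis
    unfolding E_def[symmetric] by (subst E) (use i j size in auto)
qed

section \<open>The spectrum of a partial geometric design\<close>

definition concurrence :: "'a set multiset \<Rightarrow> 'a \<Rightarrow> 'a \<Rightarrow> nat" where
  "concurrence \<B> x y = size {#B \<in># \<B>. x \<in> B \<and> y \<in> B#}"

lemma incidence_matrix_carrier [simp]:
  "incidence_matrix ps bs \<in> carrier_mat (length ps) (length bs)"
  "dim_row (incidence_matrix ps bs) = length ps" "dim_col (incidence_matrix ps bs) = length bs"
  by (simp_all add: incidence_matrix_def)

lemma incidence_matrix_index [simp]: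
  "i < length ps \<Longrightarrow> j < length bs \<Longrightarrow>
    incidence_matrix ps bs $$ (i, j) = (if ps ! i \<in> bs ! j then 1 else 0)"
  by (simp add: incidence_matrix_def)

lemma concurrence_matrix_carrier [simp]:
  "concurrence_matrix ps bs \<in> carrier_mat (length ps) (length ps)"
  "dim_row (concurrence_matrix ps bs) = length ps" "dim_col (concurrence_matrix ps bs) = length ps"
  by (simp_all add: concurrence_matrix_def carrier_matI)

lemma all_ones_mat_carrier [simp]:
  "all_ones_mat m n \<in> carrier_mat m n" "dim_row (all_ones_mat m n) = m" "dim_col (all_ones_mat m n) = n"
  by (simp_all add: all_ones_mat_def)

lemma all_ones_mat_index [simp]: "i < m \<Longrightarrow> j < n \<Longrightarrow> all_ones_mat m n $$ (i, j) = 1"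
  by (simp add: all_ones_mat_def)

lemma sum_nth_indicator:
  "(\<Sum>j<length xs. if P (xs ! j) then 1 else 0) = of_nat (size {#x \<in># mset xs. P x#})"
proof -
  have "{..<length xs} \<inter> {j. P (xs ! j)} = {j. j < length xs \<and> P (xs ! j)}"
    by auto
  then show ?thesis
    by (simp add: sum.If_cases length_filter_conv_card flip: mset_filter)
qed

lemma sum_nth_mult_indicator:
  fixes f :: "'a \<Rightarrow> 'b :: semiring_1"
  assumes "distinct xs" "A \<subseteq> set xs"
  shows "(\<Sum>i<length xs. f (xs ! i) * (if xs ! i \<in> A then 1 else 0)) = (\<Sum>x\<in>A. f x)"
proof -
  have "(\<Sum>i<length xs. f (xs ! i) * (if xs ! i \<in> A then 1 else 0)) =
      (\<Sum>x\<in>set xs. f x * (if x \<in> A then 1 else 0))"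
    using sum.reindex_bij_betw[OF bij_betw_nth[OF assms(1) refl refl]] .
  also have "\<dots> = (\<Sum>x\<in>A. f x)"
    using assms(2) by (intro sum.mono_neutral_cong_right) auto
  finally show ?thesis .
qed

lemma concurrence_matrix_index:
  assumes "i < length ps" "j < length ps"
  shows "concurrence_matrix ps bs $$ (i, j) = int (concurrence (mset bs) (ps ! i) (ps ! j))"
proof -
  have "concurrence_matrix ps bs $$ (i, j) =
      (\<Sum>m<length bs. if ps ! i \<in> bs ! m \<and> ps ! j \<in> bs ! m then 1 else 0)"
    using assms unfolding concurrence_matrix_def
    by (auto simp: scalar_prod_def lessThan_atLeast0 intro!: sum.cong)
  then show ?thesis
    by (simp only: sum_nth_indicator[of "\<lambda>B. ps ! i \<in> B \<and> ps ! j \<in> B"] concurrence_def)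
qed

locale ordered_configuration =
  fixes V :: "'a set" and \<B> v b k r ps bs
  assumes configuration: "tactical_configuration V \<B> v b k r"
    and ordering: "is_ordering ps bs V \<B>"
begin

abbreviation "N \<equiv> incidence_matrix ps bs"

abbreviation "M \<equiv> concurrence_matrix ps bs"

lemma points: "distinct ps" "set ps = V"
  using ordering by (simp_all add: is_ordering_def)

lemma blocks: "mset bs = \<B>"
  using ordering by (simp add: is_ordering_def)

lemma length_points: "length ps = v"
  using configuration points distinct_card[of ps] by (simp add: tactical_configuration_def)

lemma length_blocks: "length bs = b"
  using configuration blocks by (auto simp: tactical_configuration_def)

lemma point_mem: "i < v \<Longrightarrow> ps ! i \<in> V"
  using nth_mem[of i ps] by (simp add: points length_points)

lemma block_mem: "j < b \<Longrightarrow> bs ! j \<in># \<B>"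
  by (simp add: length_blocks flip: blocks)

lemma block_subset: "j < b \<Longrightarrow> bs ! j \<subseteq> set ps"
  and card_block: "j < b \<Longrightarrow> card (bs ! j) = k"
  using configuration block_mem by (auto simp: tactical_configuration_def points)

lemma replication_number: "i < v \<Longrightarrow> size {#B \<in># \<B>. ps ! i \<in> B#} = r"
  using configuration point_mem by (simp add: tactical_configuration_def)

lemma N_carrier: "N \<in> carrier_mat v b"
  using incidence_matrix_carrier(1)[of ps bs] by (simp add: length_points length_blocks)

lemma M_carrier: "M \<in> carrier_mat v v"
  using concurrence_matrix_carrier(1)[of ps bs] by (simp add: length_points)

lemma M_index: "i < v \<Longrightarrow> j < v \<Longrightarrow> M $$ (i, j) = int (concurrence \<B> (ps ! i) (ps ! j))"
  by (simp add: concurrence_matrix_index length_points blocks)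

lemma N_row_sum:
  assumes "i < v"
  shows "(\<Sum>j<b. N $$ (i, j)) = int r"
  using assms sum_nth_indicator[of "\<lambda>B. ps ! i \<in> B" bs, where 'a = int]
  by (simp add: length_points length_blocks blocks replication_number)

lemma N_column_sum:
  assumes "j < b"
  shows "(\<Sum>i<v. N $$ (i, j)) = int k"
  using assms sum_nth_mult_indicator[OF points(1) block_subset[OF assms], of "\<lambda>_. 1 :: int"]
  by (simp add: length_points length_blocks card_block)

lemma M_row_sum:
  assumes "i < v"
  shows "(\<Sum>j<v. M $$ (i, j)) = int (k * r)"
proof -
  have "(\<Sum>j<v. M $$ (i, j)) = (\<Sum>j<v. \<Sum>m<b. N $$ (i, m) * N $$ (j, m))"
    using assms by (simp add: concurrence_matrix_def scalar_prod_def lessThan_atLeast0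
        length_points length_blocks)
  also have "\<dots> = (\<Sum>m<b. N $$ (i, m) * (\<Sum>j<v. N $$ (j, m)))"
    by (subst sum.swap) (simp only: sum_distrib_left)
  also have "\<dots> = (\<Sum>m<b. N $$ (i, m)) * int k"
    by (simp add: N_column_sum sum_distrib_right)
  finally show ?thesis
    by (simp add: N_row_sum assms)
qed

lemma M_trace: "mat_trace M = int (v * r)"
  by (simp add: mat_trace_def length_points M_index concurrence_def replication_number)

lemma all_ones_mult_transpose_N:
  "all_ones_mat v b * transpose_mat N = int r \<cdot>\<^sub>m all_ones_mat v v"
  by (rule eq_matI) (simp_all add: scalar_prod_def lessThan_atLeast0[symmetric]
      length_points length_blocks N_row_sum del: incidence_matrix_index)

lemma triple_product_index:
  assumes "i < v" "j < b"
  shows "(N * transpose_mat N * N) $$ (i, j) = int (\<Sum>y\<in>bs ! j. concurrence \<B> (ps ! i) y)"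
proof -
  have "(N * transpose_mat N * N) $$ (i, j) = (\<Sum>m<v. M $$ (i, m) * N $$ (m, j))"
    using assms by (simp add: scalar_prod_def lessThan_atLeast0 length_points length_blocks
        flip: concurrence_matrix_def)
  also have "\<dots> = (\<Sum>m<v. int (concurrence \<B> (ps ! i) (ps ! m)) *
      (if ps ! m \<in> bs ! j then 1 else 0))"
    using assms by (intro sum.cong) (simp_all add: M_index length_points length_blocks)
  also have "\<dots> = int (\<Sum>y\<in>bs ! j. concurrence \<B> (ps ! i) y)"
    using sum_nth_mult_indicator[OF points(1) block_subset[OF assms(2)],
        of "\<lambda>y. int (concurrence \<B> (ps ! i) y)"]
    by (simp add: length_points)
  finally show ?thesis .
qed

lemma M_square:
  assumes "partial_geometric_design V \<B> v b k r \<alpha> \<beta>"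
  shows "M * M = (int \<beta> - int \<alpha>) \<cdot>\<^sub>m M + int (\<alpha> * r) \<cdot>\<^sub>m all_ones_mat v v"
proof -
  have NT: "transpose_mat N \<in> carrier_mat b v"
    using N_carrier by simp
  have "N * transpose_mat N * N = int \<beta> \<cdot>\<^sub>m N + int \<alpha> \<cdot>\<^sub>m (all_ones_mat v b - N)"
    using assms ordering by (auto simp: partial_geometric_design_def Let_def)
  also have "\<dots> = (int \<beta> - int \<alpha>) \<cdot>\<^sub>m N + int \<alpha> \<cdot>\<^sub>m all_ones_mat v b"
    by (rule eq_matI) (auto simp: length_points length_blocks algebra_simps)
  finally have MN: "M * N = \<dots>"
    by (simp add: concurrence_matrix_def)
  have "M * M = M * N * transpose_mat N"
    using assoc_mult_mat[OF M_carrier N_carrier NT] by (simp add: concurrence_matrix_def)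
  also have "\<dots> = (int \<beta> - int \<alpha>) \<cdot>\<^sub>m (N * transpose_mat N) +
      int \<alpha> \<cdot>\<^sub>m (all_ones_mat v b * transpose_mat N)"
    unfolding MN using N_carrier NT
    by (simp add: add_mult_distrib_mat[of _ v b] mult_smult_assoc_mat[of _ v b])
  also have "\<dots> = (int \<beta> - int \<alpha>) \<cdot>\<^sub>m M + int (\<alpha> * r) \<cdot>\<^sub>m all_ones_mat v v"
    unfolding all_ones_mult_transpose_N concurrence_matrix_def[symmetric]
    by (rule eq_matI) (simp_all add: length_points)
  finally show ?thesis .
qed

lemma spectrum_M:
  assumes pgd: "partial_geometric_design V \<B> v b k r \<alpha> \<beta>"
    and pos: "0 < v" "0 < r" "0 < \<alpha>" "\<alpha> < \<beta>"
    and mult: "v * r = k * r + \<sigma> * (\<beta> - \<alpha>)"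
  shows "spectrum_mset M =
    {#of_nat (k * r)#} + replicate_mset \<sigma> (of_nat (\<beta> - \<alpha>)) + replicate_mset (v - 1 - \<sigma>) 0"
  unfolding spectrum_mset_def
proof (rule proots_char_poly_quadratic_modulo_ones)
  let ?A = "map_mat complex_of_int M"
  show A: "?A \<in> carrier_mat v v"
    using M_carrier by simp
  have "?A * ?A = map_mat of_int (M * M)"
    by (rule of_int_hom.mat_hom_mult[OF M_carrier M_carrier, symmetric])
  also have "\<dots> = of_nat (\<beta> - \<alpha>) \<cdot>\<^sub>m ?A + of_nat (\<alpha> * r) \<cdot>\<^sub>m mat v v (\<lambda>_. 1)"
    unfolding M_square[OF pgd]
    by (rule eq_matI) (use pos in \<open>simp_all add: length_points of_nat_diff\<close>)
  finally show "?A * ?A = \<dots>" .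
  have "(\<Sum>j<v. ?A $$ (i, j)) = of_nat (k * r)" if "i < v" for i
  proof -
    have "(\<Sum>j<v. ?A $$ (i, j)) = of_int (\<Sum>j<v. M $$ (i, j))"
      using that by (simp add: length_points)
    then show ?thesis
      by (simp only: M_row_sum[OF that] of_int_of_nat_eq)
  qed
  then show "?A *\<^sub>v vec v (\<lambda>_. 1) = of_nat (k * r) \<cdot>\<^sub>v vec v (\<lambda>_. 1)"
    using mult_ones_vec_eq_iff_row_sums[OF A] by blast
  have "mat_trace ?A = of_int (mat_trace M)"
    by (simp add: mat_trace_def)
  also have "\<dots> = of_nat (k * r) + of_nat \<sigma> * of_nat (\<beta> - \<alpha>)"
    by (simp only: M_trace mult of_int_of_nat_eq of_nat_add of_nat_mult of_int_add of_int_mult)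
  finally show "mat_trace ?A = \<dots>" .
qed (use pos in auto)

end

lemma partial_geometric_designI:
  assumes tac: "tactical_configuration V \<B> v b k r"
    and flags: "\<And>x B. x \<in> V \<Longrightarrow> B \<in># \<B> \<Longrightarrow>
      (\<Sum>y\<in>B. concurrence \<B> x y) = (if x \<in> B then \<beta> else \<alpha>)"
  shows "partial_geometric_design V \<B> v b k r \<alpha> \<beta>"
  unfolding partial_geometric_design_def Let_def
proof (intro conjI allI impI tac)
  fix ps bs assume ord: "is_ordering ps bs V \<B>"
  interpret ordered_configuration V \<B> v b k r ps bs
    by unfold_locales (fact tac ord)+
  show "N * transpose_mat N * N = int \<beta> \<cdot>\<^sub>m N + int \<alpha> \<cdot>\<^sub>m (all_ones_mat v b - N)"
    by (rule eq_matI) (auto simp: triple_product_index flags point_mem block_mem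
        length_points length_blocks simp del: index_mult_mat(1) of_nat_sum)
qed

section \<open>Designs with prescribed concurrences up to a factor\<close>

definition concurrence_design ::
  "'a set \<Rightarrow> ('a \<Rightarrow> 'a \<Rightarrow> nat) \<Rightarrow> nat \<Rightarrow> nat \<Rightarrow> nat \<Rightarrow> nat \<Rightarrow> nat \<Rightarrow> 'a set multiset \<Rightarrow> bool" where
  "concurrence_design V C b k \<alpha> \<beta> l \<B> \<longleftrightarrow>
     size \<B> = b * l \<and>
     (\<forall>B\<in>#\<B>. B \<subseteq> V \<and> card B = k \<and> (\<forall>x\<in>V. (\<Sum>y\<in>B. C x y) = (if x \<in> B then \<beta> else \<alpha>))) \<and>
     (\<forall>x\<in>V. \<forall>y\<in>V. concurrence \<B> x y = C x y * l)"

lemma concurrence_design_union: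
  assumes "concurrence_design V C b k \<alpha> \<beta> l \<B>" "concurrence_design V C b k \<alpha> \<beta> l' \<B>'"
  shows "concurrence_design V C b k \<alpha> \<beta> (l + l') (\<B> + \<B>')"
  using assms by (auto simp: concurrence_design_def concurrence_def distrib_left)

lemma concurrence_design_exists_from_initial_segment:
  assumes "0 < m" "m \<le> l"
    and initial: "\<And>i. m \<le> i \<Longrightarrow> i < 2 * m \<Longrightarrow> \<exists>\<B>. concurrence_design V C b k \<alpha> \<beta> i \<B>"
  shows "\<exists>\<B>. concurrence_design V C b k \<alpha> \<beta> l \<B>"
  using \<open>m \<le> l\<close>
proof (induction l rule: less_induct)
  case (less l)
  show ?case
  proof (cases "l < 2 * m")
    case True
    then show ?thesis using initial less.prems by blast
  next
    case False
    then have "\<exists>\<B>. concurrence_design V C b k \<alpha> \<beta> (l - m) \<B>"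
      using less.IH[of "l - m"] \<open>0 < m\<close> by simp
    moreover have "\<exists>\<B>. concurrence_design V C b k \<alpha> \<beta> m \<B>"
      using initial[of m] \<open>0 < m\<close> by simp
    ultimately have "\<exists>\<B>. concurrence_design V C b k \<alpha> \<beta> (l - m + m) \<B>"
      using concurrence_design_union by blast
    then show ?thesis using less.prems by simp
  qed
qed

lemma concurrence_design_multiples_of_1:
  assumes "concurrence_design V C b k \<alpha> \<beta> 1 \<B>" "1 \<le> l"
  shows "\<exists>\<B>. concurrence_design V C b k \<alpha> \<beta> l \<B>"
proof (rule concurrence_design_exists_from_initial_segment[OF less_numeral_extra(1) \<open>1 \<le> l\<close>])
  fix i :: nat assume "1 \<le> i" "i < 2 * 1"
  then have "i = 1" by simp
  then show "\<exists>\<B>. concurrence_design V C b k \<alpha> \<beta> i \<B>" using assms(1) by blast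
qed

lemma concurrence_design_combinations_of_2_and_3:
  assumes "concurrence_design V C b k \<alpha> \<beta> 2 \<B>" "concurrence_design V C b k \<alpha> \<beta> 3 \<B>'" "2 \<le> l"
  shows "\<exists>\<B>. concurrence_design V C b k \<alpha> \<beta> l \<B>"
proof (rule concurrence_design_exists_from_initial_segment[OF zero_less_numeral \<open>2 \<le> l\<close>])
  fix i :: nat assume "2 \<le> i" "i < 2 * 2"
  then have "i = 2 \<or> i = 3" by linarith
  then show "\<exists>\<B>. concurrence_design V C b k \<alpha> \<beta> i \<B>" using assms by blast
qed

lemma concurrence_design_partial_geometric:
  assumes design: "concurrence_design V C b k \<alpha> \<beta> l \<B>"
    and "finite V" and diagonal: "\<And>x. x \<in> V \<Longrightarrow> C x x = r"
  shows "partial_geometric_design V \<B> (card V) (b * l) k (r * l) (\<alpha> * l) (\<beta> * l)"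
proof (rule partial_geometric_designI)
  have concurrence: "concurrence \<B> x y = C x y * l" if "x \<in> V" "y \<in> V" for x y
    using design that by (simp add: concurrence_design_def)
  show "tactical_configuration V \<B> (card V) (b * l) k (r * l)"
    using design \<open>finite V\<close> concurrence[of x x for x] diagonal
    by (auto simp: tactical_configuration_def concurrence_design_def concurrence_def)
  fix x B assume x: "x \<in> V" and B: "B \<in># \<B>"
  then have "B \<subseteq> V" and flags: "(\<Sum>y\<in>B. C x y) = (if x \<in> B then \<beta> else \<alpha>)"
    using design by (auto simp: concurrence_design_def)
  then have "(\<Sum>y\<in>B. concurrence \<B> x y) = (\<Sum>y\<in>B. C x y * l)"
    using x by (intro sum.cong concurrence) auto
  also have "\<dots> = (if x \<in> B then \<beta> * l else \<alpha> * l)"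
    using flags by (simp flip: sum_distrib_right)
  finally show "(\<Sum>y\<in>B. concurrence \<B> x y) = (if x \<in> B then \<beta> * l else \<alpha> * l)" .
qed

section \<open>Circulant concurrence matrices\<close>

definition circulant_concurrence :: "nat list \<Rightarrow> nat \<Rightarrow> nat \<Rightarrow> nat" where
  "circulant_concurrence c x y = c ! ((y + length c - x) mod length c)"

definition circulant_multiple :: "nat list \<Rightarrow> nat \<Rightarrow> int mat" where
  "circulant_multiple c l = circulant_mat (map (\<lambda>x. int (x * l)) c)"

lemma circulant_mat_dim [simp]:
  "dim_row (circulant_mat c) = length c" "dim_col (circulant_mat c) = length c"
  by (simp_all add: circulant_mat_def Let_def)

lemma circulant_mat_index:
  "i < length c \<Longrightarrow> j < length c \<Longrightarrow>
    circulant_mat c $$ (i, j) = c ! ((j + length c - i) mod length c)"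
  by (simp add: circulant_mat_def Let_def)

lemma circulant_design_concurrence_matrix:
  assumes "concurrence_design {..<length c} (circulant_concurrence c) b k \<alpha> \<beta> l (mset D)"
  shows "concurrence_matrix [0..<length c] D = circulant_multiple c l"
proof (rule eq_matI)
  fix i j
  assume "i < dim_row (circulant_multiple c l)" "j < dim_col (circulant_multiple c l)"
  then have ij: "i < length c" "j < length c"
    by (simp_all add: circulant_multiple_def)
  then have "(j + length c - i) mod length c < length c"
    by (intro mod_less_divisor) linarith
  with ij show "concurrence_matrix [0..<length c] D $$ (i, j) = circulant_multiple c l $$ (i, j)"
    using assms by (simp add: concurrence_matrix_index circulant_multiple_def circulant_mat_index
        circulant_concurrence_def concurrence_design_def)
qed (simp_all add: circulant_multiple_def)

lemma is_ordering_upt: "is_ordering [0..<n] D {..<n} (mset D)"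
  by (auto simp: is_ordering_def)

lemma circulant_design_partial_geometric:
  assumes "concurrence_design {..<length c} (circulant_concurrence c) b k \<alpha> \<beta> l \<B>"
  shows "partial_geometric_design {..<length c} \<B> (length c) (b * l) k (c ! 0 * l) (\<alpha> * l) (\<beta> * l)"
  using concurrence_design_partial_geometric[OF assms, of "c ! 0"]
  by (simp add: circulant_concurrence_def)

lemma spectrum_circulant_multiple:
  assumes design: "concurrence_design {..<length c} (circulant_concurrence c) b k \<alpha> \<beta> l (mset D)"
    and pos: "c \<noteq> []" "0 < c ! 0" "0 < \<alpha>" "\<alpha> < \<beta>" "0 < l"
    and mult: "length c * c ! 0 = k * c ! 0 + \<sigma> * (\<beta> - \<alpha>)"
  shows "spectrum_mset (circulant_multiple c l) = {#of_nat (k * (c ! 0 * l))#} +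
    replicate_mset \<sigma> (of_nat ((\<beta> - \<alpha>) * l)) + replicate_mset (length c - 1 - \<sigma>) 0"
proof -
  note pgd = circulant_design_partial_geometric[OF design]
  interpret ordered_configuration "{..<length c}" "mset D" "length c" "b * l" k "c ! 0 * l"
    "[0..<length c]" D
    using pgd is_ordering_upt by unfold_locales (simp_all add: partial_geometric_design_def)
  have "length c * (c ! 0 * l) = k * (c ! 0 * l) + \<sigma> * (\<beta> * l - \<alpha> * l)"
    using arg_cong[OF mult, of "\<lambda>x. x * l"] by (simp add: algebra_simps diff_mult_distrib)
  then show ?thesis
    using spectrum_M[OF pgd] pos
    by (simp add: circulant_design_concurrence_matrix[OF design] diff_mult_distrib)
qed

definition sym_row12 :: "nat \<Rightarrow> nat \<Rightarrow> nat \<Rightarrow> nat \<Rightarrow> nat \<Rightarrow> nat \<Rightarrow> nat \<Rightarrow> nat list" where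
  "sym_row12 c0 c1 c2 c3 c4 c5 c6 = [c0, c1, c2, c3, c4, c5, c6, c5, c4, c3, c2, c1]"

lemma circulant_multiple_sym_row12:
  "circulant_multiple (sym_row12 c0 c1 c2 c3 c4 c5 c6) l =
    sym_circulant12 (c0 * l) (c1 * l) (c2 * l) (c3 * l) (c4 * l) (c5 * l) (c6 * l)"
  by (simp add: circulant_multiple_def sym_row12_def sym_circulant12_def)

lemma realized12I:
  assumes "\<exists>\<B>. concurrence_design {..<12} (circulant_concurrence (sym_row12 c0 c1 c2 c3 c4 c5 c6))
      b k \<alpha> \<beta> l \<B>"
    and pos: "0 < c0" "0 < \<alpha>" "\<alpha> < \<beta>" "0 < l"
    and mult: "12 * c0 = k * c0 + \<sigma> * (\<beta> - \<alpha>)"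
  shows "realized12 (sym_circulant12 (c0 * l) (c1 * l) (c2 * l) (c3 * l) (c4 * l) (c5 * l) (c6 * l))
    k ((\<beta> - \<alpha>) * l) \<sigma> (b * l) (c0 * l) (\<alpha> * l) (\<beta> * l)"
proof -
  define c where "c = sym_row12 c0 c1 c2 c3 c4 c5 c6"
  have c: "length c = 12" "c ! 0 = c0" "c \<noteq> []"
    by (simp_all add: c_def sym_row12_def)
  obtain D where
    D: "concurrence_design {..<length c} (circulant_concurrence c) b k \<alpha> \<beta> l (mset D)"
    using assms(1) ex_mset c(1) unfolding c_def by metis
  have "partial_geometric_design {..<12} (mset D) 12 (b * l) k (c0 * l) (\<alpha> * l) (\<beta> * l)"
    using circulant_design_partial_geometric[OF D] by (simp add: c)
  moreover have "concurrence_matrix [0..<12] D = circulant_multiple c l"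
    using circulant_design_concurrence_matrix[OF D] by (simp add: c)
  moreover have "spectrum_mset (circulant_multiple c l) = {#of_nat (k * (c0 * l))#} +
      replicate_mset \<sigma> (of_nat ((\<beta> - \<alpha>) * l)) + replicate_mset (11 - \<sigma>) 0"
    using spectrum_circulant_multiple[OF D, of \<sigma>] pos mult by (simp add: c)
  moreover have "is_ordering [0..<12] D {..<12} (mset D)"
    by (rule is_ordering_upt)
  ultimately show ?thesis
    unfolding realized12_def circulant_multiple_sym_row12[symmetric] c_def[symmetric] by metis
qed

section \<open>Base designs\<close>

text \<open>Rows 1, 5 and 9 are transversal designs whose groups are the residue classes modulo 3, 4
  and 6. In row 9 the blocks for \<open>l = 2\<close> and \<open>l = 3\<close> encode six pairwise orthogonal balanced
  \<open>\<plusminus>1\<close> vectors of length 8 and 12; length 4 admits only three of them, which excludes \<open>l = 1\<close>.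
  In rows 2, 3, 6 and 8 the points \<open>i\<close> and \<open>i + 6\<close> lie in the same blocks, which doubles the points
  of the graphs \<open>K(3,3)\<close> and \<open>K(6)\<close>, of a transversal design with three groups of size 2 and of a
  2-(6,3,2) design; row 7 triples the points of \<open>K(4)\<close> in the same way.\<close>

lemma design_row_1:
  "concurrence_design {..<12} (circulant_concurrence (sym_row12 4 1 1 0 1 1 0)) 16 3 2 6 1
    {#{0, 1, 11}, {0, 2, 7}, {0, 4, 5}, {0, 8, 10}, {1, 2, 6},
      {1, 3, 8}, {1, 5, 9}, {2, 3, 4}, {2, 9, 10}, {3, 5, 7},
      {3, 10, 11}, {4, 6, 8}, {4, 9, 11}, {5, 6, 10}, {6, 7, 11},
      {7, 8, 9}#}"
  by code_simp

lemma realized12_row_1: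
  assumes "1 \<le> l"
  shows "realized12 (sym_circulant12 (4 * l) l l 0 l l 0)
    3 (4 * l) 9 (16 * l) (4 * l) (2 * l) (6 * l)"
  using realized12I[OF concurrence_design_multiples_of_1[OF design_row_1 assms], where \<sigma> = 9] assms
  by simp

lemma design_row_2:
  "concurrence_design {..<12} (circulant_concurrence (sym_row12 3 1 0 1 0 1 3)) 9 4 2 8 1
    {#{0, 1, 6, 7}, {0, 3, 6, 9}, {0, 5, 6, 11}, {1, 2, 7, 8}, {1, 4, 7, 10},
      {2, 3, 8, 9}, {2, 5, 8, 11}, {3, 4, 9, 10}, {4, 5, 10, 11}#}"
  by code_simp

lemma realized12_row_2:
  assumes "1 \<le> l"
  shows "realized12 (sym_circulant12 (3 * l) l 0 l 0 l (3 * l))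
    4 (6 * l) 4 (9 * l) (3 * l) (2 * l) (8 * l)"
  using realized12I[OF concurrence_design_multiples_of_1[OF design_row_2 assms], where \<sigma> = 4] assms
  by simp

lemma design_row_3:
  "concurrence_design {..<12} (circulant_concurrence (sym_row12 5 1 1 1 1 1 5)) 15 4 4 12 1
    {#{0, 1, 6, 7}, {0, 2, 6, 8}, {0, 3, 6, 9}, {0, 4, 6, 10}, {0, 5, 6, 11},
      {1, 2, 7, 8}, {1, 3, 7, 9}, {1, 4, 7, 10}, {1, 5, 7, 11}, {2, 3, 8, 9},
      {2, 4, 8, 10}, {2, 5, 8, 11}, {3, 4, 9, 10}, {3, 5, 9, 11}, {4, 5, 10, 11}#}"
  by code_simp

lemma realized12_row_3:
  assumes "1 \<le> l"
  shows "realized12 (sym_circulant12 (5 * l) l l l l l (5 * l))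
    4 (8 * l) 5 (15 * l) (5 * l) (4 * l) (12 * l)"
  using realized12I[OF concurrence_design_multiples_of_1[OF design_row_3 assms], where \<sigma> = 5] assms
  by simp

lemma design_row_4:
  "concurrence_design {..<12} (circulant_concurrence (sym_row12 4 1 1 2 1 1 0)) 12 4 4 8 1
    {#{0, 1, 3, 10}, {0, 2, 9, 11}, {0, 3, 4, 7}, {0, 5, 8, 9}, {1, 2, 4, 5},
      {1, 4, 8, 11}, {1, 6, 9, 10}, {2, 3, 5, 6}, {2, 7, 10, 11}, {3, 6, 8, 11},
      {4, 6, 7, 9}, {5, 7, 8, 10}#}"
  by code_simp

lemma realized12_row_4:
  assumes "1 \<le> l"
  shows "realized12 (sym_circulant12 (4 * l) l l (2 * l) l l 0)
    4 (4 * l) 8 (12 * l) (4 * l) (4 * l) (8 * l)"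
  using realized12I[OF concurrence_design_multiples_of_1[OF design_row_4 assms], where \<sigma> = 8] assms
  by simp

lemma design_row_5:
  "concurrence_design {..<12} (circulant_concurrence (sym_row12 3 1 1 1 0 1 1)) 9 4 3 6 1
    {#{0, 1, 2, 7}, {0, 3, 5, 6}, {0, 9, 10, 11}, {1, 3, 4, 10}, {1, 6, 8, 11},
      {2, 3, 8, 9}, {2, 4, 5, 11}, {4, 6, 7, 9}, {5, 7, 8, 10}#}"
  by code_simp

lemma realized12_row_5:
  assumes "1 \<le> l"
  shows "realized12 (sym_circulant12 (3 * l) l l l 0 l l)
    4 (3 * l) 8 (9 * l) (3 * l) (3 * l) (6 * l)"
  using realized12I[OF concurrence_design_multiples_of_1[OF design_row_5 assms], where \<sigma> = 8] assms
  by simp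

lemma design_row_6:
  "concurrence_design {..<12} (circulant_concurrence (sym_row12 2 1 1 0 1 1 2)) 4 6 4 8 1
    {#{0, 1, 5, 6, 7, 11}, {0, 2, 4, 6, 8, 10}, {1, 2, 3, 7, 8, 9}, {3, 4, 5, 9, 10, 11}#}"
  by code_simp

lemma realized12_row_6:
  assumes "1 \<le> l"
  shows "realized12 (sym_circulant12 (2 * l) l l 0 l l (2 * l))
    6 (4 * l) 3 (4 * l) (2 * l) (4 * l) (8 * l)"
  using realized12I[OF concurrence_design_multiples_of_1[OF design_row_6 assms], where \<sigma> = 3] assms
  by simp

lemma design_row_7:
  "concurrence_design {..<12} (circulant_concurrence (sym_row12 3 1 1 1 3 1 1)) 6 6 6 12 1
    {#{0, 1, 4, 5, 8, 9}, {0, 2, 4, 6, 8, 10}, {0, 3, 4, 7, 8, 11}, {1, 2, 5, 6, 9, 10},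
      {1, 3, 5, 7, 9, 11}, {2, 3, 6, 7, 10, 11}#}"
  by code_simp

lemma realized12_row_7:
  assumes "1 \<le> l"
  shows "realized12 (sym_circulant12 (3 * l) l l l (3 * l) l l)
    6 (6 * l) 3 (6 * l) (3 * l) (6 * l) (12 * l)"
  using realized12I[OF concurrence_design_multiples_of_1[OF design_row_7 assms], where \<sigma> = 3] assms
  by simp

lemma design_row_8:
  "concurrence_design {..<12} (circulant_concurrence (sym_row12 5 2 2 2 2 2 5)) 10 6 12 18 1
    {#{0, 1, 2, 6, 7, 8}, {0, 1, 5, 6, 7, 11}, {0, 2, 4, 6, 8, 10}, {0, 3, 4, 6, 9, 10},
      {0, 3, 5, 6, 9, 11}, {1, 2, 3, 7, 8, 9}, {1, 3, 4, 7, 9, 10}, {1, 4, 5, 7, 10, 11},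
      {2, 3, 5, 8, 9, 11}, {2, 4, 5, 8, 10, 11}#}"
  by code_simp

lemma realized12_row_8:
  assumes "1 \<le> l"
  shows "realized12 (sym_circulant12 (5 * l) (2 * l) (2 * l) (2 * l) (2 * l) (2 * l) (5 * l))
    6 (6 * l) 5 (10 * l) (5 * l) (12 * l) (18 * l)"
  using realized12I[OF concurrence_design_multiples_of_1[OF design_row_8 assms], where \<sigma> = 5] assms
  by simp

lemma design_row_9_2:
  "concurrence_design {..<12} (circulant_concurrence (sym_row12 2 1 1 1 1 1 0)) 4 6 5 7 2
    {#{0, 1, 3, 8, 10, 11}, {0, 1, 4, 5, 8, 9}, {0, 2, 3, 4, 5, 7}, {0, 2, 7, 9, 10, 11},
      {1, 2, 3, 4, 6, 11}, {1, 2, 5, 6, 9, 10}, {3, 5, 6, 7, 8, 10}, {4, 6, 7, 8, 9, 11}#}"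
  by code_simp

lemma design_row_9_3:
  "concurrence_design {..<12} (circulant_concurrence (sym_row12 2 1 1 1 1 1 0)) 4 6 5 7 3
    {#{0, 1, 2, 3, 4, 5}, {0, 1, 3, 8, 10, 11}, {0, 1, 4, 5, 8, 9}, {0, 2, 3, 5, 7, 10},
      {0, 2, 7, 9, 10, 11}, {0, 4, 7, 8, 9, 11}, {1, 2, 3, 4, 6, 11}, {1, 2, 6, 9, 10, 11},
      {1, 5, 6, 8, 9, 10}, {2, 4, 5, 6, 7, 9}, {3, 4, 6, 7, 8, 11}, {3, 5, 6, 7, 8, 10}#}"
  by code_simp

lemma realized12_row_9:
  assumes "2 \<le> l"
  shows "realized12 (sym_circulant12 (2 * l) l l l l l 0)
    6 (2 * l) 6 (4 * l) (2 * l) (5 * l) (7 * l)"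
  using realized12I[OF concurrence_design_combinations_of_2_and_3[OF
      design_row_9_2 design_row_9_3 assms],
    where \<sigma> = 6] assms
  by simp

lemma design_row_10:
  "concurrence_design {..<12} (circulant_concurrence (sym_row12 7 3 4 3 4 3 1)) 14 6 18 24 1
    {#{0, 1, 2, 3, 5, 10}, {0, 1, 2, 9, 10, 11}, {0, 1, 4, 5, 8, 9}, {0, 2, 4, 5, 7, 9},
      {0, 2, 4, 6, 8, 10}, {0, 3, 4, 7, 8, 11}, {0, 3, 7, 8, 10, 11}, {1, 2, 3, 4, 6, 11},
      {1, 3, 4, 5, 6, 8}, {1, 3, 5, 7, 9, 11}, {1, 6, 8, 9, 10, 11}, {2, 3, 5, 6, 7, 10},
      {2, 4, 6, 7, 9, 11}, {5, 6, 7, 8, 9, 10}#}"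
  by code_simp

lemma realized12_row_10:
  assumes "1 \<le> l"
  shows "realized12 (sym_circulant12 (7 * l) (3 * l) (4 * l) (3 * l) (4 * l) (3 * l) l)
    6 (6 * l) 7 (14 * l) (7 * l) (18 * l) (24 * l)"
  using realized12I[OF concurrence_design_multiples_of_1[OF design_row_10 assms],
    where \<sigma> = 7] assms
  by simp

lemma design_row_11:
  "concurrence_design {..<12} (circulant_concurrence (sym_row12 6 3 3 2 3 3 2)) 12 6 16 20 1
    {#{0, 1, 2, 9, 10, 11}, {0, 1, 3, 5, 7, 11}, {0, 1, 5, 6, 8, 10}, {0, 2, 3, 4, 8, 10},
      {0, 2, 4, 6, 7, 11}, {0, 4, 5, 7, 8, 9}, {1, 2, 3, 4, 5, 9}, {1, 2, 3, 6, 7, 8},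
      {1, 4, 6, 8, 9, 11}, {2, 5, 6, 7, 9, 10}, {3, 4, 5, 6, 10, 11}, {3, 7, 8, 9, 10, 11}#}"
  by code_simp

lemma realized12_row_11:
  assumes "1 \<le> l"
  shows "realized12 (sym_circulant12 (6 * l) (3 * l) (3 * l) (2 * l) (3 * l) (3 * l) (2 * l))
    6 (4 * l) 9 (12 * l) (6 * l) (16 * l) (20 * l)"
  using realized12I[OF concurrence_design_multiples_of_1[OF design_row_11 assms],
    where \<sigma> = 9] assms
  by simp

section \<open>Families of multiples of a circulant matrix\<close>

lemma circulant_mat_inject:
  assumes "circulant_mat c = circulant_mat c'"
  shows "c = c'"
proof (rule nth_equalityI)
  show length: "length c = length c'"
    using arg_cong[OF assms, of dim_row] by simp
  fix j assume j: "j < length c"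
  then have "0 < length c" by linarith
  with j have "circulant_mat c $$ (0, j) = c ! j" "circulant_mat c' $$ (0, j) = c' ! j"
    by (simp_all add: circulant_mat_index flip: length)
  then show "c ! j = c' ! j" using assms by simp
qed

text \<open>The factor \<open>l\<close> is recovered from a multiple of a primitive matrix as the gcd of its
  entries.\<close>

lemma circulant_multiple_inject:
  assumes eq: "circulant_multiple c l = circulant_multiple c' l'"
    and primitive: "Gcd (set c) = 1" "Gcd (set c') = 1"
  shows "l = l'" and "0 < l \<Longrightarrow> c = c'"
proof -
  have "map int (map ((*) l) c) = map int (map ((*) l') c')"
    using circulant_mat_inject[OF eq[unfolded circulant_multiple_def]]
    by (simp add: o_def mult.commute)
  then have map_eq: "map ((*) l) c = map ((*) l') c'"
    by (rule map_injective) (simp add: inj_def)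
  have "Gcd (set (map ((*) l) c)) = Gcd (set (map ((*) l') c'))"
    by (simp only: map_eq)
  then show "l = l'"
    using primitive by (simp add: Gcd_mult)
  with map_eq have "map ((*) l) c = map ((*) l) c'"
    by simp
  then show "c = c'" if "0 < l"
    by (rule map_injective) (use that in \<open>simp add: inj_def\<close>)
qed

definition circulant_family :: "nat \<times> nat list \<Rightarrow> int mat set" where
  "circulant_family = (\<lambda>(m, c). circulant_multiple c ` {m..})"

lemma infinite_circulant_family:
  assumes "Gcd (set c) = 1"
  shows "infinite (circulant_family (m, c))"
proof -
  have "inj_on (circulant_multiple c) {m..}"
    using circulant_multiple_inject(1) assms by (blast intro: inj_onI)
  then show ?thesis
    by (simp add: circulant_family_def finite_image_iff infinite_Ici)
qed

lemma circulant_family_disjoint: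
  assumes "Gcd (set c) = 1" "Gcd (set c') = 1" "0 < m" "c \<noteq> c'"
  shows "circulant_family (m, c) \<inter> circulant_family (m', c') = {}"
  using circulant_multiple_inject(2)[OF _ assms(1,2)] assms(3,4)
  by (fastforce simp: circulant_family_def)

lemma primitive_circulant_families:
  assumes primitive: "\<And>m c. (m, c) \<in> T \<Longrightarrow> 0 < m \<and> Gcd (set c) = 1" and "inj_on snd T"
  shows "card (circulant_family ` T) = card T"
    and "disjoint (circulant_family ` T)"
    and "F \<in> circulant_family ` T \<Longrightarrow> infinite F"
proof -
  show infinite: "infinite F" if "F \<in> circulant_family ` T" for F
    using that primitive infinite_circulant_family by force
  have "disjoint_family_on circulant_family T"
    unfolding disjoint_family_on_def
  proof (intro ballI impI)
    fix p q assume pq: "p \<in> T" "q \<in> T" "p \<noteq> q"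
    then have "snd p \<noteq> snd q"
      using \<open>inj_on snd T\<close> by (auto dest: inj_onD)
    then show "circulant_family p \<inter> circulant_family q = {}"
      using pq primitive circulant_family_disjoint by (metis prod.collapse)
  qed
  moreover have "circulant_family p \<noteq> {}" if "p \<in> T" for p
    using infinite that by fastforce
  ultimately have "disjoint (circulant_family ` T) \<and> inj_on circulant_family T"
    by (simp add: disjoint_family_on_iff_disjoint_image)
  then show "disjoint (circulant_family ` T)" "card (circulant_family ` T) = card T"
    by (simp_all add: card_image)
qed

definition concurrence_families :: "int mat set set" where
  "concurrence_families =
    {{sym_circulant12 (4 * l) l l 0 l l 0 | l. l \<ge> 1},
     {sym_circulant12 (3 * l) l 0 l 0 l (3 * l) | l. l \<ge> 1},
     {sym_circulant12 (5 * l) l l l l l (5 * l) | l. l \<ge> 1},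
     {sym_circulant12 (4 * l) l l (2 * l) l l 0 | l. l \<ge> 1},
     {sym_circulant12 (3 * l) l l l 0 l l | l. l \<ge> 1},
     {sym_circulant12 (2 * l) l l 0 l l (2 * l) | l. l \<ge> 1},
     {sym_circulant12 (3 * l) l l l (3 * l) l l | l. l \<ge> 1},
     {sym_circulant12 (5 * l) (2 * l) (2 * l) (2 * l) (2 * l) (2 * l) (5 * l) | l. l \<ge> 1},
     {sym_circulant12 (2 * l) l l l l l 0 | l. l \<ge> 2},
     {sym_circulant12 (7 * l) (3 * l) (4 * l) (3 * l) (4 * l) (3 * l) l | l. l \<ge> 1},
     {sym_circulant12 (6 * l) (3 * l) (3 * l) (2 * l) (3 * l) (3 * l) (2 * l) | l. l \<ge> 1}}"

definition circulant_family_table :: "(nat \<times> nat list) list" where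
  "circulant_family_table =
    [(1, sym_row12 4 1 1 0 1 1 0),
     (1, sym_row12 3 1 0 1 0 1 3),
     (1, sym_row12 5 1 1 1 1 1 5),
     (1, sym_row12 4 1 1 2 1 1 0),
     (1, sym_row12 3 1 1 1 0 1 1),
     (1, sym_row12 2 1 1 0 1 1 2),
     (1, sym_row12 3 1 1 1 3 1 1),
     (1, sym_row12 5 2 2 2 2 2 5),
     (2, sym_row12 2 1 1 1 1 1 0),
     (1, sym_row12 7 3 4 3 4 3 1),
     (1, sym_row12 6 3 3 2 3 3 2)]"

lemma circulant_family_sym_row12:
  "circulant_family (m, sym_row12 c0 c1 c2 c3 c4 c5 c6) =
    {sym_circulant12 (c0 * l) (c1 * l) (c2 * l) (c3 * l) (c4 * l) (c5 * l) (c6 * l) | l. l \<ge> m}"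
  by (auto simp: circulant_family_def circulant_multiple_sym_row12)

lemma concurrence_families_eq: "concurrence_families = circulant_family ` set circulant_family_table"
  by (simp add: concurrence_families_def circulant_family_table_def circulant_family_sym_row12)

lemma concurrence_families_card_disjoint_infinite:
  shows "card concurrence_families = 11" "disjoint concurrence_families"
    and "F \<in> concurrence_families \<Longrightarrow> infinite F"
proof -
  have "\<forall>(m, c)\<in>set circulant_family_table. 0 < m \<and> Gcd (set c) = 1"
    by code_simp
  then have primitive: "0 < m \<and> Gcd (set c) = 1" if "(m, c) \<in> set circulant_family_table" for m c
    using that by blast
  have distinct: "distinct (map snd circulant_family_table)"
    by code_simp
  then have "card (set circulant_family_table) = 11"
    by (simp add: distinct_card distinct_map) (simp add: circulant_family_table_def)
  then show "card concurrence_families = 11" "disjoint concurrence_families"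
    "F \<in> concurrence_families \<Longrightarrow> infinite F"
    using primitive_circulant_families[of "set circulant_family_table", OF primitive] distinct
    by (simp_all add: concurrence_families_eq distinct_map)
qed

lemma transpose_concurrence_matrix:
  "transpose_mat (concurrence_matrix ps bs) = concurrence_matrix ps bs"
  unfolding concurrence_matrix_def
  by (subst transpose_mult[of _ "length ps" "length bs"]) auto

lemma realized12_imp_is_pgd_concurrence_matrix:
  "realized12 A k n \<sigma> b r \<alpha> \<beta> \<Longrightarrow> is_pgd_concurrence_matrix A"
  unfolding realized12_def is_pgd_concurrence_matrix_def by blast

lemma realized12_imp_sym_integral_circulant:
  assumes "realized12 (sym_circulant12 c0 c1 c2 c3 c4 c5 c6) k n \<sigma> b r \<alpha> \<beta>"
  shows "sym_integral_circulant 12 (sym_circulant12 c0 c1 c2 c3 c4 c5 c6)"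
proof -
  let ?C = "sym_circulant12 c0 c1 c2 c3 c4 c5 c6"
  obtain ps :: "nat list" and bs where C: "concurrence_matrix ps bs = ?C"
    and spectrum: "spectrum_mset ?C =
      {#of_nat (k * r)#} + replicate_mset \<sigma> (of_nat n) + replicate_mset (11 - \<sigma>) 0"
    using assms unfolding realized12_def by metis
  have "transpose_mat ?C = ?C"
    using transpose_concurrence_matrix[of ps bs] by (simp only: C)
  moreover have "?C \<in> carrier_mat 12 12"
    unfolding sym_circulant12_def by (rule carrier_matI) simp_all
  moreover have "\<exists>c. length c = 12 \<and> ?C = circulant_mat c"
    unfolding sym_circulant12_def by (rule exI, rule conjI[OF _ refl]) simp
  moreover have "set_mset (spectrum_mset ?C) \<subseteq> \<int>"
    unfolding spectrum by (auto split: if_splits)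
  ultimately show ?thesis
    unfolding sym_integral_circulant_def by blast
qed

lemmas realized12_rows =
  realized12_row_1 realized12_row_2 realized12_row_3 realized12_row_4 realized12_row_5
  realized12_row_6 realized12_row_7 realized12_row_8 realized12_row_9 realized12_row_10
  realized12_row_11

lemma concurrence_families_realized:
  assumes "F \<in> concurrence_families" "A \<in> F"
  shows "sym_integral_circulant 12 A" "is_pgd_concurrence_matrix A"
  using assms unfolding concurrence_families_def
  by (auto intro: realized12_rows[THEN realized12_imp_sym_integral_circulant]
      realized12_rows[THEN realized12_imp_is_pgd_concurrence_matrix])

theorem theorem5p2:
  shows "(\<forall>l\<ge>1. realized12 (sym_circulant12 (4 * l) l l 0 l l 0) 3 (4 * l) 9 (16 * l) (4 * l) (2 * l) (6 * l)) \<and>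
    (\<forall>l\<ge>1. realized12 (sym_circulant12 (3 * l) l 0 l 0 l (3 * l)) 4 (6 * l) 4 (9 * l) (3 * l) (2 * l) (8 * l)) \<and>
    (\<forall>l\<ge>1. realized12 (sym_circulant12 (5 * l) l l l l l (5 * l)) 4 (8 * l) 5 (15 * l) (5 * l) (4 * l) (12 * l)) \<and>
    (\<forall>l\<ge>1. realized12 (sym_circulant12 (4 * l) l l (2 * l) l l 0) 4 (4 * l) 8 (12 * l) (4 * l) (4 * l) (8 * l)) \<and>
    (\<forall>l\<ge>1. realized12 (sym_circulant12 (3 * l) l l l 0 l l) 4 (3 * l) 8 (9 * l) (3 * l) (3 * l) (6 * l)) \<and>
    (\<forall>l\<ge>1. realized12 (sym_circulant12 (2 * l) l l 0 l l (2 * l)) 6 (4 * l) 3 (4 * l) (2 * l) (4 * l) (8 * l)) \<and>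
    (\<forall>l\<ge>1. realized12 (sym_circulant12 (3 * l) l l l (3 * l) l l) 6 (6 * l) 3 (6 * l) (3 * l) (6 * l) (12 * l)) \<and>
    (\<forall>l\<ge>1. realized12 (sym_circulant12 (5 * l) (2 * l) (2 * l) (2 * l) (2 * l) (2 * l) (5 * l)) 6 (6 * l) 5 (10 * l) (5 * l) (12 * l) (18 * l)) \<and>
    (\<forall>l\<ge>2. realized12 (sym_circulant12 (2 * l) l l l l l 0) 6 (2 * l) 6 (4 * l) (2 * l) (5 * l) (7 * l)) \<and>
    (\<forall>l\<ge>1. realized12 (sym_circulant12 (7 * l) (3 * l) (4 * l) (3 * l) (4 * l) (3 * l) l) 6 (6 * l) 7 (14 * l) (7 * l) (18 * l) (24 * l)) \<and>
    (\<forall>l\<ge>1. realized12 (sym_circulant12 (6 * l) (3 * l) (3 * l) (2 * l) (3 * l) (3 * l) (2 * l)) 6 (4 * l) 9 (12 * l) (6 * l) (16 * l) (20 * l)) \<and>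
    (let \<F> =
      {{sym_circulant12 (4 * l) l l 0 l l 0 | l. l \<ge> 1},
       {sym_circulant12 (3 * l) l 0 l 0 l (3 * l) | l. l \<ge> 1},
       {sym_circulant12 (5 * l) l l l l l (5 * l) | l. l \<ge> 1},
       {sym_circulant12 (4 * l) l l (2 * l) l l 0 | l. l \<ge> 1},
       {sym_circulant12 (3 * l) l l l 0 l l | l. l \<ge> 1},
       {sym_circulant12 (2 * l) l l 0 l l (2 * l) | l. l \<ge> 1},
       {sym_circulant12 (3 * l) l l l (3 * l) l l | l. l \<ge> 1},
       {sym_circulant12 (5 * l) (2 * l) (2 * l) (2 * l) (2 * l) (2 * l) (5 * l) | l. l \<ge> 1},
       {sym_circulant12 (2 * l) l l l l l 0 | l. l \<ge> 2},
       {sym_circulant12 (7 * l) (3 * l) (4 * l) (3 * l) (4 * l) (3 * l) l | l. l \<ge> 1},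
       {sym_circulant12 (6 * l) (3 * l) (3 * l) (2 * l) (3 * l) (3 * l) (2 * l) | l. l \<ge> 1}}
     in card \<F> = 11 \<and> disjoint \<F> \<and>
        (\<forall>F \<in> \<F>. infinite F \<and>
           (\<forall>M \<in> F. sym_integral_circulant 12 M \<and> is_pgd_concurrence_matrix M)))"
proof -
  have "card concurrence_families = 11 \<and> disjoint concurrence_families \<and>
      (\<forall>F\<in>concurrence_families. infinite F \<and>
        (\<forall>A\<in>F. sym_integral_circulant 12 A \<and> is_pgd_concurrence_matrix A))"
    using concurrence_families_card_disjoint_infinite concurrence_families_realized by blast
  then show ?thesis
    unfolding Let_def concurrence_families_def[symmetric]
    by (intro conjI allI impI realized12_rows) simp_all
qed

end
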